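(* Let $2\le t\le b\le M-b$. Let $\mathcal{D}$ be an $\mathbb{F}_q$-linear space of $b\times(M-b)$ matrices over $\mathbb{F}_q$ with $|\mathcal{D}|=q^{(M-b)t}$, containing an $\mathbb{F}_q$-linear subspace $\mathcal{A}$ with $|\mathcal{A}|=q^{M-b}$ in which every nonzero matrix has rank $b$. For $D\in\mathcal{D}$ let $V_D=\{(\overline{x},\overline{x}D):\overline{x}\in\mathbb{F}_q^b\}\subseteq\mathbb{F}_q^M$, and let $C$ be the array code whose columns are associated with the subspaces $V_D$, $D\in\mathcal{D}$, each exactly once. Then $C$ is a $[b\times q^{(M-b)t},\,M,\,d]$ array code with $$d=q^{(M-b)(t-1)}\left(q^{M-b}-q^{M-2b}\right);$$ its symbol locality is $r_{\mathrm s}=1$, its node locality satisfies $r_{\mathrm n}\ge2$, and its symbol availability is $t_{\mathrm s}=q^{(M-b)(t-1)}-1$.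
   Context: $q$ is a prime power. (In the paper, the subspaces $V_D$ are the blocks of a resolvable subspace transversal design of strength $t$, whose parallel classes are $\{V_D: D\in D_0+\mathcal{A}\}$ for the cosets $D_0+\mathcal{A}$ of $\mathcal{A}$ in $\mathcal{D}$.) A $[b\times n,M,d]$ array code over $\mathbb{F}_q$ is an $\mathbb{F}_q$-linear space of $b\times n$ matrices of dimension $M$; weight is the number of nonzero columns and $d$ is the minimum weight of a nonzero codeword. Given $b$-dimensional subspaces $V_1,\dots,V_n$ of $\mathbb{F}_q^M$, the array code whose columns are associated with them is obtained by placing a basis of $V_j$ as columns $(j-1)b+1,\dots,jb$ (the $j$th thick column) of an $M\times bn$ matrix $G$ and taking all arrays whose column-by-column flattening lies in the row space of $G$. A recovery set for codeword column $j$ is a set $S\subseteq[n]\setminus\{j\}$ with $V_j\subseteq\sum_{k\in S}V_k$; for symbol $(i,j)$ it is a set $S\subseteq[n]\setminus\{j\}$ such that the $i$th column of the $j$th thick column of $G$ lies in $\sum_{k\in S}V_k$. Node (resp. symbol) locality is the smallest $r$ such that every column (resp. symbol) has a recovery set of size at most $r$. Symbol availability $t_{\mathrm s}$ is the largest $t$ such that every symbol has $t$ pairwise-disjoint recovery sets each of size at most $r_{\mathrm s}$. *)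

theory Defs
  imports Main "HOL-Library.Function_Algebras" "HOL-Library.Extended_Nat"
begin

definition fvec :: "nat \<Rightarrow> (nat \<Rightarrow> 'a::zero) set" where
  "fvec n = {v. \<forall>i\<ge>n. v i = 0}"

definition fmat :: "nat \<Rightarrow> nat \<Rightarrow> (nat \<Rightarrow> nat \<Rightarrow> 'a::zero) set" where
  "fmat r c = {A. \<forall>i j. (r \<le> i \<or> c \<le> j) \<longrightarrow> A i j = 0}"

definition fscale :: "'a::times \<Rightarrow> (nat \<Rightarrow> 'a) \<Rightarrow> (nat \<Rightarrow> 'a)" where
  "fscale c v = (\<lambda>i. c * v i)"

definition mscale :: "'a::times \<Rightarrow> (nat \<Rightarrow> nat \<Rightarrow> 'a) \<Rightarrow> (nat \<Rightarrow> nat \<Rightarrow> 'a)" where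
  "mscale c A = (\<lambda>i j. c * A i j)"

definition mat_subspace :: "(nat \<Rightarrow> nat \<Rightarrow> 'a::field) set \<Rightarrow> bool" where
  "mat_subspace S \<longleftrightarrow> 0 \<in> S \<and> (\<forall>A\<in>S. \<forall>B\<in>S. A + B \<in> S) \<and> (\<forall>c. \<forall>A\<in>S. mscale c A \<in> S)"

definition mat_rank :: "nat \<Rightarrow> (nat \<Rightarrow> nat \<Rightarrow> 'a::field) \<Rightarrow> nat" where
  "mat_rank r A = vector_space.dim (fscale :: 'a \<Rightarrow> _) {(\<lambda>j. A i j) | i. i < r}"

(* V_D = {(x, xD) : x in F^b} inside F^M  (D a b x (M-b) matrix) *)
definition VD :: "nat \<Rightarrow> (nat \<Rightarrow> nat \<Rightarrow> 'a::comm_ring) \<Rightarrow> (nat \<Rightarrow> 'a) set" where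
  "VD b D = {v. \<exists>x\<in>fvec b. v = (\<lambda>k. if k < b then x k else (\<Sum>i<b. x i * D i (k - b)))}"

definition is_basis :: "nat \<Rightarrow> (nat \<Rightarrow> 'a) set \<Rightarrow> (nat \<Rightarrow> nat \<Rightarrow> 'a::field) \<Rightarrow> bool" where
  "is_basis b V g \<longleftrightarrow> (\<forall>i<b. g i \<in> V) \<and>
     (\<forall>v\<in>V. \<exists>!c. c \<in> fvec b \<and> v = (\<Sum>i<b. fscale (c i) (g i)))"

(* The array code whose columns are associated with the subspaces V 0 .. V (n-1),
   where g j 0, ..., g j (b-1) is the chosen basis of V j (the j-th thick column of G).
   Codewords are b x n arrays: entry (i,j) of the codeword of message u is u . g j i. *)
definition encode :: "nat \<Rightarrow> nat \<Rightarrow> nat \<Rightarrow> (nat \<Rightarrow> nat \<Rightarrow> nat \<Rightarrow> 'a::comm_ring) \<Rightarrow> (nat \<Rightarrow> 'a)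
     \<Rightarrow> (nat \<Rightarrow> nat \<Rightarrow> 'a)" where
  "encode M b n g u = (\<lambda>i j. if i < b \<and> j < n then (\<Sum>k<M. u k * g j i k) else 0)"

definition array_code :: "nat \<Rightarrow> nat \<Rightarrow> nat \<Rightarrow> (nat \<Rightarrow> nat \<Rightarrow> nat \<Rightarrow> 'a::comm_ring)
     \<Rightarrow> (nat \<Rightarrow> nat \<Rightarrow> 'a) set" where
  "array_code M b n g = encode M b n g ` fvec M"

definition array_weight :: "nat \<Rightarrow> nat \<Rightarrow> (nat \<Rightarrow> nat \<Rightarrow> 'a::zero) \<Rightarrow> nat" where
  "array_weight b n A = card {j. j < n \<and> (\<exists>i<b. A i j \<noteq> 0)}"

definition min_distance :: "nat \<Rightarrow> nat \<Rightarrow> (nat \<Rightarrow> nat \<Rightarrow> 'a::zero) set \<Rightarrow> nat" where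
  "min_distance b n C = Min {array_weight b n A | A. A \<in> C \<and> A \<noteq> 0}"

definition subspace_sum :: "(nat \<Rightarrow> (nat \<Rightarrow> 'a::comm_monoid_add) set) \<Rightarrow> nat set \<Rightarrow> (nat \<Rightarrow> 'a) set" where
  "subspace_sum V S = {(\<Sum>k\<in>S. w k) | w. \<forall>k\<in>S. w k \<in> V k}"

definition node_recovery_set :: "nat \<Rightarrow> (nat \<Rightarrow> (nat \<Rightarrow> 'a::comm_monoid_add) set) \<Rightarrow> nat \<Rightarrow> nat set \<Rightarrow> bool" where
  "node_recovery_set n V j S \<longleftrightarrow> S \<subseteq> {..<n} - {j} \<and> V j \<subseteq> subspace_sum V S"

definition symbol_recovery_set :: "nat \<Rightarrow> (nat \<Rightarrow> (nat \<Rightarrow> 'a::comm_monoid_add) set)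
     \<Rightarrow> (nat \<Rightarrow> nat \<Rightarrow> nat \<Rightarrow> 'a) \<Rightarrow> nat \<Rightarrow> nat \<Rightarrow> nat set \<Rightarrow> bool" where
  "symbol_recovery_set n V g i j S \<longleftrightarrow> S \<subseteq> {..<n} - {j} \<and> g j i \<in> subspace_sum V S"

(* localities (infinity if no such r exists) *)
definition node_locality :: "nat \<Rightarrow> (nat \<Rightarrow> (nat \<Rightarrow> 'a::comm_monoid_add) set) \<Rightarrow> enat" where
  "node_locality n V = Inf {enat r | r. \<forall>j<n. \<exists>S. node_recovery_set n V j S \<and> card S \<le> r}"

definition symbol_locality :: "nat \<Rightarrow> nat \<Rightarrow> (nat \<Rightarrow> (nat \<Rightarrow> 'a::comm_monoid_add) set)
     \<Rightarrow> (nat \<Rightarrow> nat \<Rightarrow> nat \<Rightarrow> 'a) \<Rightarrow> enat" where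
  "symbol_locality b n V g =
     Inf {enat r | r. \<forall>j<n. \<forall>i<b. \<exists>S. symbol_recovery_set n V g i j S \<and> card S \<le> r}"

definition symbol_availability :: "nat \<Rightarrow> nat \<Rightarrow> (nat \<Rightarrow> (nat \<Rightarrow> 'a::comm_monoid_add) set)
     \<Rightarrow> (nat \<Rightarrow> nat \<Rightarrow> nat \<Rightarrow> 'a) \<Rightarrow> enat" where
  "symbol_availability b n V g =
     Sup {enat a | a. \<forall>j<n. \<forall>i<b. \<exists>F :: nat \<Rightarrow> nat set.
        (\<forall>l<a. symbol_recovery_set n V g i j (F l) \<and> enat (card (F l)) \<le> symbol_locality b n V g) \<and>
        (\<forall>l<a. \<forall>l'<a. l \<noteq> l' \<longrightarrow> F l \<inter> F l' = {})}"

end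

theory Submission
  imports Defs "HOL-Library.FuncSet"
begin

text \<open>
  For a nonzero row vector \<open>x\<close>, the map \<open>A \<mapsto> x A\<close> is injective on \<open>\<A>\<close> because nonzero matrices of
  \<open>\<A>\<close> have full row rank, so it is onto by counting. For a nonzero column vector \<open>y\<close>, the map
  \<open>A \<mapsto> A y\<close> is onto as well: a nonzero \<open>x\<close> orthogonal to its image would make \<open>y\<close> orthogonal to
  every \<open>x A\<close>, that is, to the whole space. Hence on \<open>\<D>\<close> all fibres of \<open>D \<mapsto> x D\<close> and of
  \<open>D \<mapsto> D y\<close> are cosets of equal size. Column \<open>D\<close> of the codeword of \<open>(u, y)\<close> vanishes iff
  \<open>D y = - u\<close>, so the second count gives the weights. A symbol \<open>(x, x D)\<close> lies in \<open>V\<^sub>E\<close> iff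
  \<open>x E = x D\<close>, so the first count gives its singleton recovery sets.
\<close>

section \<open>Fibres of additive maps\<close>

lemma mat_subspace_diff:
  assumes "mat_subspace S" "A \<in> S" "B \<in> S"
  shows "A - B \<in> S"
proof -
  have "A - B = A + mscale (-1) B" by (intro ext) (simp add: mscale_def)
  then show ?thesis using assms unfolding mat_subspace_def by metis
qed

text \<open>Closure under differences makes the nonempty set \<open>S\<close> a subgroup, so
  translation by a preimage \<open>s0\<close> of \<open>z\<close> matches the fibre over
  \<open>z\<close> with the kernel.\<close>

lemma card_additive_fibre:
  fixes h :: "'b::ab_group_add \<Rightarrow> 'c::ab_group_add"
  assumes diff: "\<And>x y. x \<in> S \<Longrightarrow> y \<in> S \<Longrightarrow> x - y \<in> S"
    and h_diff: "\<And>x y. x \<in> S \<Longrightarrow> y \<in> S \<Longrightarrow> h (x - y) = h x - h y"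
    and z: "z \<in> h ` S"
  shows "card {s \<in> S. h s = z} = card {s \<in> S. h s = 0}"
proof -
  obtain s0 where s0: "s0 \<in> S" "z = h s0" using z by blast
  have add: "x + y \<in> S" "h (x + y) = h x + h y" if "x \<in> S" "y \<in> S" for x y
  proof -
    have 0: "0 \<in> S" "h 0 = 0" using diff[of x x] h_diff[of x x] that by auto
    have n: "- y \<in> S" "h (- y) = - h y" using diff[of 0 y] h_diff[of 0 y] that 0 by auto
    show "x + y \<in> S" "h (x + y) = h x + h y"
      using diff[of x "- y"] h_diff[of x "- y"] that n by auto
  qed
  have "bij_betw (\<lambda>s. s - s0) {s \<in> S. h s = z} {s \<in> S. h s = 0}"
    by (rule bij_betw_byWitness[where f' = "\<lambda>s. s + s0"]) (use s0 diff h_diff add in auto)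
  then show ?thesis by (rule bij_betw_same_card)
qed

text \<open>The fibres over the image partition \<open>S\<close>, and each is as large as the
  kernel.\<close>

lemma card_additive_image_kernel:
  fixes h :: "'b::ab_group_add \<Rightarrow> 'c::ab_group_add"
  assumes fin: "finite S"
    and diff: "\<And>x y. x \<in> S \<Longrightarrow> y \<in> S \<Longrightarrow> x - y \<in> S"
    and h_diff: "\<And>x y. x \<in> S \<Longrightarrow> y \<in> S \<Longrightarrow> h (x - y) = h x - h y"
  shows "card S = card (h ` S) * card {s \<in> S. h s = 0}"
proof -
  have "card S = (\<Sum>z\<in>h ` S. card {s \<in> S. h s = z})"
    using sum.image_gen[OF fin, of "\<lambda>_. 1::nat" h] by simp
  also have "\<dots> = (\<Sum>z\<in>h ` S. card {s \<in> S. h s = 0})"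
    by (intro sum.cong refl card_additive_fibre diff h_diff)
  finally show ?thesis by simp
qed

section \<open>Linear algebra of vectors of bounded length\<close>

lemma sum_apply:
  fixes f :: "'i \<Rightarrow> 'b \<Rightarrow> 'c::comm_monoid_add"
  shows "(\<Sum>i\<in>I. f i) k = (\<Sum>i\<in>I. f i k)"
  by (induction I rule: infinite_finite_induct) auto

text \<open>Restriction to \<open>{..<n}\<close> identifies these vectors with extensional
  functions; padding with 0 is the inverse.\<close>

lemma card_fvec: "card (fvec n :: (nat \<Rightarrow> 'a::{finite,zero}) set) = card (UNIV :: 'a set) ^ n"
proof -
  have "bij_betw (\<lambda>v. restrict v {..<n}) (fvec n :: (nat \<Rightarrow> 'a) set) ({..<n} \<rightarrow>\<^sub>E UNIV)"
    by (rule bij_betw_byWitness[where f' = "\<lambda>v i. if i < n then v i else 0"])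
      (auto simp: fvec_def fun_eq_iff PiE_def extensional_def restrict_def)
  then show ?thesis by (simp add: bij_betw_same_card card_PiE)
qed

lemma finite_fvec: "finite (fvec n :: (nat \<Rightarrow> 'a::{finite,zero}) set)"
proof -
  have "card (UNIV :: 'a set) > 0" by (simp add: card_gt_0_iff)
  then show ?thesis by (intro card_ge_0_finite) (simp add: card_fvec)
qed

interpretation fvec_space: vector_space "fscale :: 'a::field \<Rightarrow> (nat \<Rightarrow> 'a) \<Rightarrow> (nat \<Rightarrow> 'a)"
  by unfold_locales (auto simp: fscale_def fun_eq_iff algebra_simps)

text \<open>A basis of \<open>W\<close> stays independent when a vector \<open>v\<close> outside
  \<open>W\<close> is added, so some linear functional vanishes on \<open>W\<close> and is 1 at
  \<open>v\<close>. Its coordinates form \<open>x\<close>.\<close>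

lemma exists_annihilator:
  fixes W :: "(nat \<Rightarrow> 'a::field) set"
  assumes sub: "fvec_space.subspace W" and WS: "W \<subseteq> fvec b" and ne: "W \<noteq> fvec b"
  obtains x where "x \<in> fvec b" "x \<noteq> 0" "\<And>w. w \<in> W \<Longrightarrow> (\<Sum>i<b. x i * w i) = 0"
proof -
  \<comment> \<open>The field is taken as a vector space over itself, so that functionals are linear
    maps into it.\<close>
  interpret fvec_functional:
    vector_space_pair "fscale :: 'a \<Rightarrow> (nat \<Rightarrow> 'a) \<Rightarrow> (nat \<Rightarrow> 'a)" "(*) :: 'a \<Rightarrow> 'a \<Rightarrow> 'a"
    by unfold_locales (auto simp: algebra_simps)
  obtain v where v: "v \<in> fvec b" "v \<notin> W" using WS ne by blast
  obtain B where B: "B \<subseteq> W" "fvec_space.independent B" "W \<subseteq> fvec_space.span B"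
    using fvec_space.maximal_independent_subset by blast
  have sB: "fvec_space.span B = W"
    using B sub by (simp add: fvec_space.span_minimal subset_antisym)
  have ind: "fvec_space.independent (insert v B)"
    using B v sB by (simp add: fvec_space.independent_insert)
  obtain f where f: "Vector_Spaces.linear fscale (*) f"
    and fB: "\<forall>w\<in>insert v B. f w = (if w = v then 1 else 0)"
    using fvec_functional.linear_independent_extend[OF ind, of "\<lambda>w. if w = v then 1 else 0"] by blast
  interpret f: Vector_Spaces.linear fscale "(*)" f by (rule f)
  \<comment> \<open>The values of \<open>f\<close> on the unit vectors, padded with 0 to lie in
    \<open>fvec b\<close>.\<close>
  define x where "x = (\<lambda>i. if i < b then f (\<lambda>k. if k = i then 1 else 0) else 0)"
  have fx: "f w = (\<Sum>i<b. x i * w i)" if "w \<in> fvec b" for w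
  proof -
    have "w = (\<Sum>i<b. fscale (w i) (\<lambda>k. if k = i then 1 else 0))"
      using that by (auto simp: fun_eq_iff fscale_def sum_apply fvec_def if_distrib[of "\<lambda>c. _ * c"]
          cong: if_cong)
    then have "f w = f (\<Sum>i<b. fscale (w i) (\<lambda>k. if k = i then 1 else 0))" by simp
    also have "\<dots> = (\<Sum>i<b. x i * w i)"
      by (simp add: f.sum f.scale x_def mult.commute)
    finally show ?thesis .
  qed
  have "f w = 0" if "w \<in> W" for w
  proof (rule fvec_functional.linear_eq_0_on_span[OF f])
    show "w \<in> fvec_space.span B" using that sB by simp
    show "f z = 0" if "z \<in> B" for z using fB that B v by auto
  qed
  moreover have "f v = 1" using fB by simp
  ultimately have "x \<noteq> 0" "\<And>w. w \<in> W \<Longrightarrow> (\<Sum>i<b. x i * w i) = 0"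
    using fx[OF v(1)] fx[OF subsetD[OF WS]] by auto
  moreover have "x \<in> fvec b" by (simp add: x_def fvec_def)
  ultimately show thesis using that by blast
qed

section \<open>Products of matrices with row and column vectors\<close>

definition vmul :: "nat \<Rightarrow> (nat \<Rightarrow> 'a::comm_ring) \<Rightarrow> (nat \<Rightarrow> nat \<Rightarrow> 'a) \<Rightarrow> nat \<Rightarrow> 'a" where
  "vmul b x D = (\<lambda>l. \<Sum>i<b. x i * D i l)"

definition mulv :: "nat \<Rightarrow> (nat \<Rightarrow> nat \<Rightarrow> 'a::comm_ring) \<Rightarrow> (nat \<Rightarrow> 'a) \<Rightarrow> nat \<Rightarrow> 'a" where
  "mulv m D y = (\<lambda>i. \<Sum>l<m. D i l * y l)"

lemma vmul_diff: "vmul b x (D - E) = vmul b x D - vmul b x E"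
  by (auto simp: vmul_def fun_eq_iff sum_subtractf right_diff_distrib)

lemma mulv_diff: "mulv m (D - E) y = mulv m D y - mulv m E y"
  by (auto simp: mulv_def fun_eq_iff sum_subtractf left_diff_distrib)

lemma vmul_in_fvec: "D \<in> fmat b m \<Longrightarrow> vmul b x D \<in> fvec m"
  by (auto simp: vmul_def fmat_def fvec_def)

lemma mulv_in_fvec: "D \<in> fmat b m \<Longrightarrow> mulv m D y \<in> fvec b"
  by (auto simp: mulv_def fmat_def fvec_def)

text \<open>Associativity, \<open>(x D) y = x (D y)\<close>: the bridge between the actions on rows
  and on columns.\<close>

lemma sum_vmul_eq_sum_mulv:
  "(\<Sum>l<m. vmul b x D l * y l) = (\<Sum>i<b. x i * mulv m D y i)"
proof -
  have "(\<Sum>l<m. vmul b x D l * y l) = (\<Sum>l<m. \<Sum>i<b. x i * D i l * y l)"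
    by (simp add: vmul_def sum_distrib_right)
  also have "\<dots> = (\<Sum>i<b. \<Sum>l<m. x i * D i l * y l)" by (rule sum.swap)
  finally show ?thesis by (simp add: mulv_def sum_distrib_left mult.assoc)
qed

text \<open>Rank \<open>b\<close> makes the \<open>b\<close> rows of \<open>A\<close> distinct and
  independent, and \<open>x A\<close> is their combination with coefficients
  \<open>x\<close>.\<close>

lemma vmul_full_rank_eq_0:
  fixes A :: "nat \<Rightarrow> nat \<Rightarrow> 'a::field"
  assumes rank: "mat_rank b A = b" and x: "x \<in> fvec b" and 0: "vmul b x A = 0"
  shows "x = 0"
proof -
  define R where "R = A ` {..<b}"
  have R: "R = {(\<lambda>j. A i j) | i. i < b}" by (auto simp: R_def)
  have dim: "fvec_space.dim R = b" using rank by (simp add: mat_rank_def R)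
  obtain B where B: "B \<subseteq> R" "fvec_space.independent B" "card B = fvec_space.dim R"
    using fvec_space.basis_exists[of R] by metis
  have finR: "finite R" and cardR: "card R \<le> b"
    using card_image_le[of "{..<b}" A] by (auto simp: R_def)
  \<comment> \<open>The basis \<open>B\<close> has \<open>b\<close> elements and \<open>R\<close> at
    most \<open>b\<close>, so no row lies outside the basis.\<close>
  have "B = R" using B finR cardR dim by (intro card_seteq) auto
  then have ind: "fvec_space.independent R" and "card R = b" using B dim by auto
  then have inj: "inj_on A {..<b}" by (intro eq_card_imp_inj_on) (auto simp: R_def)
  \<comment> \<open>Independence concerns the set of rows, so the coefficients are moved from row
    indices to the rows themselves; injectivity of \<open>A\<close> on the indices allows
    this.\<close>
  define c where "c = (\<lambda>r. x (the_inv_into {..<b} A r))"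
  have cA: "c (A i) = x i" if "i < b" for i
    using that inj by (simp add: c_def the_inv_into_f_f)
  have "(\<Sum>r\<in>R. fscale (c r) r) = (\<Sum>i<b. fscale (x i) (A i))"
    unfolding R_def by (simp add: sum.reindex[OF inj] cA)
  also have "\<dots> = vmul b x A" by (auto simp: fun_eq_iff vmul_def fscale_def sum_apply)
  finally have "\<And>r. r \<in> R \<Longrightarrow> c r = 0"
    using fvec_space.independentD[OF ind finR subset_refl] 0 by simp
  then have "x i = 0" if "i < b" for i using cA[OF that] that by (force simp: R_def)
  with x show ?thesis unfolding fvec_def fun_eq_iff
    by (metis (mono_tags, lifting) mem_Collect_eq not_le zero_fun_apply)
qed

text \<open>A difference of two matrices with the same product lies in \<open>\<A>\<close> and is
  killed by \<open>x\<close>, so full rank forces it to be 0. Injectivity gives surjectivity because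
  \<open>\<A>\<close> and \<open>fvec m\<close> are equally large.\<close>

lemma vmul_image_full_rank_space:
  fixes \<A> :: "(nat \<Rightarrow> nat \<Rightarrow> 'a::{finite,field}) set"
  assumes sub: "mat_subspace \<A>" and mats: "\<A> \<subseteq> fmat b m"
    and card: "card \<A> = card (UNIV :: 'a set) ^ m"
    and rank: "\<And>A. A \<in> \<A> \<Longrightarrow> A \<noteq> 0 \<Longrightarrow> mat_rank b A = b"
    and x: "x \<in> fvec b" "x \<noteq> 0"
  shows "vmul b x ` \<A> = fvec m"
proof -
  have "inj_on (vmul b x) \<A>"
  proof (rule inj_onI)
    fix A B assume AB: "A \<in> \<A>" "B \<in> \<A>" "vmul b x A = vmul b x B"
    then have "A - B \<in> \<A>" "vmul b x (A - B) = 0"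
      using sub by (auto simp: mat_subspace_diff vmul_diff)
    then have "A - B = 0" using rank x vmul_full_rank_eq_0 by blast
    then show "A = B" by simp
  qed
  then have "card (vmul b x ` \<A>) = card (fvec m :: (nat \<Rightarrow> 'a) set)"
    by (simp add: card_image card card_fvec)
  then show ?thesis
    using mats by (intro card_subset_eq finite_fvec) (auto intro: vmul_in_fvec)
qed

text \<open>A proper image would be annihilated by some \<open>x \<noteq> 0\<close>. Then
  \<open>(x A) y = 0\<close> for every \<open>A\<close> in \<open>\<A>\<close>, although
  \<open>x A\<close> runs through all of \<open>fvec m\<close>.\<close>

lemma mulv_image_full_rank_space:
  fixes \<A> :: "(nat \<Rightarrow> nat \<Rightarrow> 'a::{finite,field}) set"
  assumes sub: "mat_subspace \<A>" and mats: "\<A> \<subseteq> fmat b m"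
    and card: "card \<A> = card (UNIV :: 'a set) ^ m"
    and rank: "\<And>A. A \<in> \<A> \<Longrightarrow> A \<noteq> 0 \<Longrightarrow> mat_rank b A = b"
    and y: "l < m" "y l \<noteq> 0"
  shows "(\<lambda>A. mulv m A y) ` \<A> = fvec b"
proof (rule ccontr)
  let ?W = "(\<lambda>A. mulv m A y) ` \<A>"
  assume ne: "?W \<noteq> fvec b"
  have "fvec_space.subspace ?W"
  proof (rule fvec_space.subspaceI)
    have "(0::nat \<Rightarrow> 'a) = mulv m 0 y" by (auto simp: mulv_def fun_eq_iff)
    then show "0 \<in> ?W" using sub unfolding mat_subspace_def by blast
    show "v + w \<in> ?W" if vw: "v \<in> ?W" "w \<in> ?W" for v w
    proof -
      obtain A B where AB: "A \<in> \<A>" "B \<in> \<A>" "v = mulv m A y" "w = mulv m B y" using vw by blast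
      then have "v + w = mulv m (A + B) y"
        by (auto simp: mulv_def fun_eq_iff sum.distrib distrib_right)
      then show ?thesis using AB sub unfolding mat_subspace_def by blast
    qed
    show "fscale c v \<in> ?W" if v: "v \<in> ?W" for c v
      using v
    proof (rule imageE)
      fix A assume A: "v = mulv m A y" "A \<in> \<A>"
      have "fscale c v = mulv m (mscale c A) y"
        unfolding mulv_def fscale_def mscale_def A by (simp add: sum_distrib_left mult.assoc)
      moreover have "mscale c A \<in> \<A>" using A sub unfolding mat_subspace_def by blast
      ultimately show ?thesis by (rule image_eqI)
    qed
  qed
  moreover have "?W \<subseteq> fvec b" using mats by (auto intro: mulv_in_fvec)
  ultimately obtain x where x: "x \<in> fvec b" "x \<noteq> 0"
    and perp: "\<And>w. w \<in> ?W \<Longrightarrow> (\<Sum>i<b. x i * w i) = 0"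
    using ne exists_annihilator by blast
  have "vmul b x ` \<A> = fvec m"
    using vmul_image_full_rank_space[OF sub mats card rank x] .
  \<comment> \<open>Choosing \<open>x A\<close> to be this unit vector makes \<open>(x A) y\<close>
    equal to the nonzero entry \<open>y l\<close>.\<close>
  moreover have "(\<lambda>k. if k = l then 1 else 0) \<in> (fvec m :: (nat \<Rightarrow> 'a) set)"
    using y by (auto simp: fvec_def)
  ultimately have "(\<lambda>k. if k = l then 1 else 0) \<in> vmul b x ` \<A>" by simp
  then obtain A where A: "A \<in> \<A>" "vmul b x A = (\<lambda>k. if k = l then 1 else 0)"
    by (elim imageE) simp
  have "y l = (\<Sum>k<m. vmul b x A k * y k)"
    using y unfolding A by (simp add: if_distrib[of "\<lambda>c. c * _"] cong: if_cong)
  also have "\<dots> = (\<Sum>i<b. x i * mulv m A y i)" by (rule sum_vmul_eq_sum_mulv)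
  also have "\<dots> = 0" using perp[of "mulv m A y"] A by simp
  finally show False using y by simp
qed


section \<open>Membership in the subspaces \<open>VD b D\<close>\<close>

lemma vmul_cong: "(\<And>i. i < b \<Longrightarrow> x i = y i) \<Longrightarrow> vmul b x D = vmul b y D"
  by (simp add: vmul_def)

text \<open>The first \<open>b\<close> entries of a member are its \<open>x\<close>, and
  \<open>vmul b\<close> reads only those. For fixed \<open>v\<close>, membership thus places
  \<open>D\<close> in a fibre of \<open>vmul b v\<close>.\<close>

lemma mem_VD_iff: "v \<in> VD b D \<longleftrightarrow> vmul b v D = (\<lambda>l. v (b + l))"
proof
  assume "v \<in> VD b D"
  then obtain x where "v = (\<lambda>k. if k < b then x k else (\<Sum>i<b. x i * D i (k - b)))"
    by (auto simp: VD_def)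
  then show "vmul b v D = (\<lambda>l. v (b + l))" by (simp add: vmul_def)
next
  assume *: "vmul b v D = (\<lambda>l. v (b + l))"
  let ?x = "\<lambda>i. if i < b then v i else 0"
  have "v k = (\<Sum>i<b. ?x i * D i (k - b))" if "\<not> k < b" for k
    using fun_cong[OF *, of "k - b"] that by (simp add: vmul_def)
  then have "v = (\<lambda>k. if k < b then ?x k else (\<Sum>i<b. ?x i * D i (k - b)))" by fastforce
  then show "v \<in> VD b D" unfolding VD_def fvec_def by (intro CollectI bexI[of _ ?x]) auto
qed

section \<open>Fibre sizes over \<open>\<D>\<close>\<close>

locale full_rank_family =
  fixes \<D> \<A> :: "(nat \<Rightarrow> nat \<Rightarrow> 'a::{finite,field}) set" and b m :: nat
  assumes D_mats: "\<D> \<subseteq> fmat b m" and D_sub: "mat_subspace \<D>" and D_fin: "finite \<D>"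
    and A_in: "\<A> \<subseteq> \<D>" and A_sub: "mat_subspace \<A>"
    and A_card: "card \<A> = card (UNIV :: 'a set) ^ m"
    and A_rank: "\<And>A. A \<in> \<A> \<Longrightarrow> A \<noteq> 0 \<Longrightarrow> mat_rank b A = b"
begin

lemma A_mats: "\<A> \<subseteq> fmat b m"
  using A_in D_mats by blast

lemma vmul_image:
  assumes x: "i < b" "x i \<noteq> 0"
  shows "vmul b x ` \<D> = fvec m"
proof
  show "vmul b x ` \<D> \<subseteq> fvec m" using D_mats by (auto intro: vmul_in_fvec)
  \<comment> \<open>\<open>x\<close> may have nonzero entries from \<open>b\<close> on;
    \<open>vmul b\<close> ignores them, and truncation gives a vector of
    \<open>fvec b\<close>.\<close>
  let ?x = "\<lambda>i. if i < b then x i else 0"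
  have "?x \<in> fvec b" by (simp add: fvec_def)
  moreover have "?x \<noteq> 0" using x by (auto simp: fun_eq_iff)
  ultimately have "vmul b ?x ` \<A> = fvec m"
    by (intro vmul_image_full_rank_space[OF A_sub A_mats A_card A_rank])
  moreover have "vmul b ?x = vmul b x" by (intro ext[of "vmul b ?x"] vmul_cong) simp
  ultimately show "fvec m \<subseteq> vmul b x ` \<D>" using A_in by auto
qed

lemma mulv_image:
  assumes y: "l < m" "y l \<noteq> 0"
  shows "(\<lambda>D. mulv m D y) ` \<D> = fvec b"
proof
  show "(\<lambda>D. mulv m D y) ` \<D> \<subseteq> fvec b" using D_mats by (auto intro: mulv_in_fvec)
  have "(\<lambda>D. mulv m D y) ` \<A> = fvec b"
    using y by (intro mulv_image_full_rank_space[OF A_sub A_mats A_card A_rank])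
  then show "fvec b \<subseteq> (\<lambda>D. mulv m D y) ` \<D>" using A_in by auto
qed

text \<open>All vectors of \<open>fvec m\<close> are attained, each by equally many matrices. The
  product form avoids division.\<close>

lemma card_vmul_fibre:
  assumes "i < b" "x i \<noteq> 0" "z \<in> fvec m"
  shows "card (UNIV :: 'a set) ^ m * card {D \<in> \<D>. vmul b x D = z} = card \<D>"
  using card_additive_fibre[of \<D> "vmul b x" z] card_additive_image_kernel[OF D_fin, of "vmul b x"]
    vmul_image[of i x] assms mat_subspace_diff[OF D_sub]
  by (simp add: vmul_diff card_fvec)

lemma card_mulv_fibre:
  assumes "l < m" "y l \<noteq> 0" "z \<in> fvec b"
  shows "card (UNIV :: 'a set) ^ b * card {D \<in> \<D>. mulv m D y = z} = card \<D>"
  using card_additive_fibre[of \<D> "\<lambda>D. mulv m D y" z]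
    card_additive_image_kernel[OF D_fin, of "\<lambda>D. mulv m D y"]
    mulv_image[of l y] assms mat_subspace_diff[OF D_sub]
  by (simp add: mulv_diff card_fvec)

text \<open>The matrices counted form the fibre of \<open>vmul b v\<close> over the tail of
  \<open>v\<close>. A nonzero \<open>v\<close> in \<open>VD b D\<close> has a nonzero entry below
  \<open>b\<close>, as otherwise its tail would vanish too.\<close>

lemma card_VD_containing:
  assumes D: "D \<in> \<D>" and v: "v \<in> VD b D" "v \<noteq> 0"
  shows "card (UNIV :: 'a set) ^ m * card {E \<in> \<D>. v \<in> VD b E} = card \<D>"
proof -
  have vD: "vmul b v D = (\<lambda>l. v (b + l))" using v by (simp add: mem_VD_iff)
  have "\<exists>i<b. v i \<noteq> 0"
  proof (rule ccontr)
    assume "\<not> (\<exists>i<b. v i \<noteq> 0)"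
    then have low: "v i = 0" if "i < b" for i using that by blast
    then have "v (b + l) = 0" for l using fun_cong[OF vD, of l] by (simp add: vmul_def)
    then have "v k = 0" for k using low[of k] by (metis le_add_diff_inverse not_le)
    then show False using v by (auto simp: fun_eq_iff)
  qed
  then obtain i where i: "i < b" "v i \<noteq> 0" by blast
  have "(\<lambda>l. v (b + l)) \<in> fvec m" using D D_mats vmul_in_fvec[of D b m v] vD by auto
  from card_vmul_fibre[of i v, OF i this] show ?thesis by (simp add: mem_VD_iff)
qed

end

section \<open>Vanishing columns of a codeword\<close>

lemma sum_lessThan_add:
  fixes f :: "nat \<Rightarrow> 'a::comm_monoid_add"
  shows "(\<Sum>k<b + m. f k) = (\<Sum>k<b. f k) + (\<Sum>l<m. f (b + l))"
  by (induction m) (auto simp: add.assoc)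

text \<open>The tail of \<open>v\<close> is \<open>x D\<close> with \<open>x\<close> its first
  \<open>b\<close> entries; associativity moves \<open>D\<close> over to the tail of
  \<open>u\<close>.\<close>

lemma sum_mult_mem_VD:
  assumes "v \<in> VD b D"
  shows "(\<Sum>k<b + m. u k * v k) = (\<Sum>i<b. v i * (u i + mulv m D (\<lambda>l. u (b + l)) i))"
proof -
  have "(\<Sum>l<m. u (b + l) * v (b + l)) = (\<Sum>l<m. vmul b v D l * u (b + l))"
    using assms by (simp add: mem_VD_iff mult.commute)
  also have "\<dots> = (\<Sum>i<b. v i * mulv m D (\<lambda>l. u (b + l)) i)" by (rule sum_vmul_eq_sum_mulv)
  finally show ?thesis
    by (simp add: sum_lessThan_add distrib_left sum.distrib mult.commute)
qed

text \<open>A zero basis vector would be represented both by zero coefficients and by the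
  \<open>i\<close>-th unit coefficients, against uniqueness.\<close>

lemma is_basis_nonzero:
  fixes g :: "nat \<Rightarrow> nat \<Rightarrow> 'a::field"
  assumes g: "is_basis b V g" and i: "i < b"
  shows "g i \<noteq> 0"
proof
  assume 0: "g i = 0"
  let ?P = "\<lambda>c. c \<in> fvec b \<and> g i = (\<Sum>k<b. fscale (c k) (g k))"
  have "g i \<in> V" using g i by (simp add: is_basis_def)
  then have ex1: "\<exists>!c. ?P c" using g unfolding is_basis_def by blast
  have "?P (\<lambda>k. 0)" using 0 by (auto simp: fvec_def fscale_def fun_eq_iff sum_apply)
  moreover have "?P (\<lambda>k. if k = i then 1 else 0)"
    using 0 i by (auto simp: fvec_def fscale_def fun_eq_iff sum_apply intro!: sum.neutral)
  ultimately have "(\<lambda>k. 0) = (\<lambda>k. if k = i then 1 else (0::'a))" by (rule Uniq_D[OF ex1[unfolded ex1_iff_ex_Uniq, THEN conjunct2]])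
  from fun_cong[OF this, of i] show False by simp
qed

text \<open>Orthogonality to a basis is orthogonality to all of \<open>VD b D\<close>. With
  \<open>y\<close> the tail of \<open>u\<close>, the pairing with \<open>(x, x D)\<close> is
  \<open>x (u + D y)\<close> on the first \<open>b\<close> entries, which vanishes for all
  \<open>x\<close> iff \<open>D y = - u\<close> there.\<close>

lemma column_eq_0_iff:
  fixes D :: "nat \<Rightarrow> nat \<Rightarrow> 'a::field"
  assumes D: "D \<in> fmat b m" and g: "is_basis b (VD b D) g"
  shows "(\<forall>i<b. (\<Sum>k<b + m. u k * g i k) = 0) \<longleftrightarrow>
    mulv m D (\<lambda>l. u (b + l)) = (\<lambda>i. if i < b then - u i else 0)" (is "?L \<longleftrightarrow> ?R")
proof
  assume ?R
  then have "u i + mulv m D (\<lambda>l. u (b + l)) i = 0" if "i < b" for i using that by simp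
  moreover have "g i \<in> VD b D" if "i < b" for i using g that by (simp add: is_basis_def)
  ultimately show ?L by (simp add: sum_mult_mem_VD[of _ b D])
next
  assume L: ?L
  have dot: "(\<Sum>k<b + m. u k * v k) = 0" if v: "v \<in> VD b D" for v
  proof -
    obtain c where "v = (\<Sum>i<b. fscale (c i) (g i))" using g v unfolding is_basis_def by blast
    then have "(\<Sum>k<b + m. u k * v k) = (\<Sum>k<b + m. \<Sum>i<b. c i * (u k * g i k))"
      by (simp add: sum_apply fscale_def sum_distrib_left mult.left_commute)
    also have "\<dots> = (\<Sum>i<b. \<Sum>k<b + m. c i * (u k * g i k))" by (rule sum.swap)
    also have "\<dots> = 0" using L by (simp add: sum_distrib_left[symmetric])
    finally show ?thesis .
  qed
  have "mulv m D (\<lambda>l. u (b + l)) i = - u i" if i: "i < b" for i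
  proof -
    \<comment> \<open>The \<open>i\<close>-th unit vector followed by row \<open>i\<close> of
      \<open>D\<close>; pairing with it isolates the \<open>i\<close>-th equation.\<close>
    let ?v = "\<lambda>k. if k < b then (if k = i then 1 else 0) else D i (k - b)"
    have "?v \<in> VD b D"
      using i by (auto simp: mem_VD_iff vmul_def fun_eq_iff if_distrib[of "\<lambda>c. c * _"] cong: if_cong)
    from dot[OF this] sum_mult_mem_VD[OF this, where m = m and u = u]
    have "(\<Sum>k<b. (if k = i then 1 else 0) * (u k + mulv m D (\<lambda>l. u (b + l)) k)) = 0" by simp
    then have "u i + mulv m D (\<lambda>l. u (b + l)) i = 0"
      using i by (simp add: if_distrib[of "\<lambda>c. c * _"] cong: if_cong)
    then show ?thesis by (simp add: eq_neg_iff_add_eq_0 add.commute)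
  qed
  moreover have "mulv m D (\<lambda>l. u (b + l)) i = 0" if "\<not> i < b" for i
    using mulv_in_fvec[OF D] that by (simp add: fvec_def)
  ultimately show ?R by auto
qed

section \<open>Recovery sets, localities and availability\<close>

lemma subspace_sum_empty: "subspace_sum V {} = {0}"
  by (auto simp: subspace_sum_def)

lemma subspace_sum_singleton: "subspace_sum V {k} = V k"
  by (auto simp: subspace_sum_def)

text \<open>The empty set generates only 0, and a single column recovers exactly the vectors it
  contains.\<close>

lemma symbol_recovery_set_card_le_1_iff:
  assumes v: "g j i \<noteq> 0" and S: "card S \<le> 1"
  shows "symbol_recovery_set n V g i j S \<longleftrightarrow> (\<exists>k. S = {k} \<and> k < n \<and> k \<noteq> j \<and> g j i \<in> V k)"
proof
  assume rec: "symbol_recovery_set n V g i j S"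
  \<comment> \<open>Lying in \<open>{..<n}\<close> excludes an infinite \<open>S\<close>, whose
    \<open>card\<close> would be 0.\<close>
  then have "finite S" "S \<noteq> {}"
    using v finite_subset[of S "{..<n} - {j}"]
    by (auto simp: symbol_recovery_set_def subspace_sum_empty)
  then have "card S = 1" using S by (simp add: le_antisym Suc_leI card_gt_0_iff)
  then obtain k where "S = {k}" by (rule card_1_singletonE)
  then show "\<exists>k. S = {k} \<and> k < n \<and> k \<noteq> j \<and> g j i \<in> V k"
    using rec by (auto simp: symbol_recovery_set_def subspace_sum_singleton)
qed (auto simp: symbol_recovery_set_def subspace_sum_singleton)

text \<open>Singletons show that \<open>r = 1\<close> suffices; \<open>r = 0\<close> fails since the
  symbol at \<open>(0, 0)\<close> is nonzero.\<close>

lemma symbol_locality_eq_1: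
  assumes pos: "0 < n" "0 < b"
    and nz: "\<And>i j. j < n \<Longrightarrow> i < b \<Longrightarrow> g j i \<noteq> 0"
    and ex: "\<And>i j. j < n \<Longrightarrow> i < b \<Longrightarrow> \<exists>k<n. k \<noteq> j \<and> g j i \<in> V k"
  shows "symbol_locality b n V g = 1"
proof -
  let ?R = "{enat r | r. \<forall>j<n. \<forall>i<b. \<exists>S. symbol_recovery_set n V g i j S \<and> card S \<le> r}"
  have "\<exists>S. symbol_recovery_set n V g i j S \<and> card S \<le> 1" if ji: "j < n" "i < b" for i j
  proof -
    obtain k where "k < n" "k \<noteq> j" "g j i \<in> V k" using ex ji by blast
    then show ?thesis using nz[OF ji] by (intro exI[of _ "{k}"]) (simp add: symbol_recovery_set_card_le_1_iff)
  qed
  then have "enat 1 \<in> ?R" by blast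
  then have "Inf ?R \<le> 1" unfolding one_enat_def by (rule Inf_lower)
  moreover have "1 \<le> Inf ?R"
  proof (rule Inf_greatest)
    fix e assume "e \<in> ?R"
    then obtain r S where r: "e = enat r" "symbol_recovery_set n V g 0 0 S" "card S \<le> r"
      using pos by blast
    then have "r \<noteq> 0" using symbol_recovery_set_card_le_1_iff[of g 0 0 S n V] nz pos by force
    then show "1 \<le> e" using r by (simp add: one_enat_def)
  qed
  ultimately show ?thesis unfolding symbol_locality_def by (rule antisym)
qed

text \<open>At locality 1 the admissible recovery sets are the singletons of other columns
  containing the symbol, so a disjoint family is an injective choice of such columns.\<close>

lemma symbol_availability_of_locality_1:
  assumes pos: "0 < n" "0 < b"
    and nz: "\<And>i j. j < n \<Longrightarrow> i < b \<Longrightarrow> g j i \<noteq> 0"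
    and loc: "symbol_locality b n V g = 1"
    and card: "\<And>i j. j < n \<Longrightarrow> i < b \<Longrightarrow> card {k. k < n \<and> k \<noteq> j \<and> g j i \<in> V k} = a"
  shows "symbol_availability b n V g = enat a"
proof -
  let ?K = "\<lambda>i j. {k. k < n \<and> k \<noteq> j \<and> g j i \<in> V k}"
  let ?avail = "\<lambda>c i j F. (\<forall>l<c. symbol_recovery_set n V g i j (F l)
      \<and> enat (card (F l)) \<le> symbol_locality b n V g)
    \<and> (\<forall>l<c. \<forall>l'<c. l \<noteq> l' \<longrightarrow> F l \<inter> F l' = {})"
  let ?R = "{enat c | c. \<forall>j<n. \<forall>i<b. \<exists>F :: nat \<Rightarrow> nat set. ?avail c i j F}"
  have "Sup ?R \<le> enat a"
  proof (rule Sup_least)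
    fix e assume "e \<in> ?R"
    \<comment> \<open>One symbol suffices for the upper bound, because availability requires the
      family for every symbol.\<close>
    then obtain c F where e: "e = enat c" and F: "?avail c 0 0 F" using pos by blast
    have single: "\<exists>k. F l = {k} \<and> k \<in> ?K 0 0" if "l < c" for l
      using F that symbol_recovery_set_card_le_1_iff[of g 0 0 "F l" n V] nz pos
      by (auto simp: loc one_enat_def)
    have "inj_on F {..<c}"
    proof (rule inj_onI)
      fix l l' assume l: "l \<in> {..<c}" "l' \<in> {..<c}" "F l = F l'"
      then have "F l \<inter> F l' \<noteq> {}" using single[of l] by auto
      then show "l = l'" using F l by blast
    qed
    then have "c = card (F ` {..<c})" by (simp add: card_image)
    also have "\<dots> \<le> card ((\<lambda>k. {k}) ` ?K 0 0)" using single by (intro card_mono) auto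
    also have "\<dots> \<le> a" using card_image_le[of "?K 0 0"] card pos by force
    finally show "e \<le> enat a" by (simp add: e)
  qed
  moreover have "enat a \<in> ?R"
  proof -
    have avail: "\<forall>j<n. \<forall>i<b. \<exists>F. ?avail a i j F"
    proof (intro allI impI)
      fix j i assume ji: "j < n" "i < b"
      have "finite (?K i j)" by simp
      then obtain f where f: "bij_betw f {0..<a} (?K i j)"
        using ex_bij_betw_nat_finite[of "?K i j"] card[OF ji] by auto
      show "\<exists>F. ?avail a i j F"
      proof (intro exI[of _ "\<lambda>l. {f l}"] conjI allI impI)
        fix l assume "l < a"
        then have "f l \<in> ?K i j" using bij_betw_apply[OF f, of l] by simp
        then show "symbol_recovery_set n V g i j {f l}"
          using nz[OF ji] by (simp add: symbol_recovery_set_card_le_1_iff)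
      next
        fix l l' assume "l < a" "l' < a" "l \<noteq> l'"
        then have "f l \<noteq> f l'" using f by (auto simp: bij_betw_def inj_on_def)
        then show "{f l} \<inter> {f l'} = {}" by simp
      qed (simp add: loc one_enat_def)
    qed
    show ?thesis
    proof (rule CollectI, rule exI[of _ a], rule conjI)
      show "enat a = enat a" by (rule refl)
    qed (rule avail)
  qed
  ultimately show ?thesis
    unfolding symbol_availability_def by (intro antisym Sup_upper)
qed

text \<open>The member of \<open>VD b D\<close> formed by the \<open>i\<close>-th unit vector and
  row \<open>i\<close> of \<open>D\<close> lies in \<open>VD b E\<close> only if row
  \<open>i\<close> of \<open>E\<close> is the same.\<close>

lemma VD_subset_imp_eq:
  fixes D E :: "nat \<Rightarrow> nat \<Rightarrow> 'a::field"
  assumes D: "D \<in> fmat b m" and E: "E \<in> fmat b m" and sub: "VD b D \<subseteq> VD b E"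
  shows "D = E"
proof -
  have "D i l = E i l" if i: "i < b" for i l
  proof -
    let ?v = "\<lambda>k. if k < b then (if k = i then 1 else 0) else D i (k - b)"
    have row: "vmul b ?v F = F i" for F :: "nat \<Rightarrow> nat \<Rightarrow> 'a"
      using i by (auto simp: vmul_def fun_eq_iff if_distrib[of "\<lambda>c. c * _"] cong: if_cong)
    have "?v \<in> VD b D" by (simp add: mem_VD_iff row)
    then have "?v \<in> VD b E" using sub by blast
    then show ?thesis by (simp add: mem_VD_iff row)
  qed
  moreover have "D i l = E i l" if "\<not> i < b" for i l using D E that by (simp add: fmat_def)
  ultimately show ?thesis by (intro ext) blast
qed

text \<open>The empty set recovers only the zero space, and a single column recovers only subspaces
  of its own.\<close>

lemma node_locality_ge_2:
  assumes n: "0 < n"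
    and nz: "\<And>j. j < n \<Longrightarrow> \<not> V j \<subseteq> {0}"
    and inj: "\<And>j k. j < n \<Longrightarrow> k < n \<Longrightarrow> V j \<subseteq> V k \<Longrightarrow> j = k"
  shows "2 \<le> node_locality n V"
  unfolding node_locality_def
proof (rule Inf_greatest)
  fix e assume "e \<in> {enat r | r. \<forall>j<n. \<exists>S. node_recovery_set n V j S \<and> card S \<le> r}"
  then obtain r S where r: "e = enat r" "node_recovery_set n V 0 S" "card S \<le> r"
    using n by blast
  then have fin: "finite S" using finite_subset[of S "{..<n} - {0}"]
    by (auto simp: node_recovery_set_def)
  have "\<not> card S \<le> 1"
  proof
    assume "card S \<le> 1"
    then consider "S = {}" | k where "S = {k}"
      using fin card_1_singletonE[of S] by (cases "card S = 0") force+
    then show False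
      using r nz[OF n] inj[OF n]
      by cases (auto simp: node_recovery_set_def subspace_sum_empty subspace_sum_singleton)
  qed
  then show "2 \<le> e" using r by (simp add: numeral_eq_enat)
qed


section \<open>Weights of codewords\<close>

lemma encode_diff: "encode M b n g (u - w) = encode M b n g u - encode M b n g w"
  by (auto simp: encode_def fun_eq_iff sum_subtractf left_diff_distrib)

lemma array_weight_encode:
  "array_weight b n (encode M b n g u) = n - card {j. j < n \<and> (\<forall>i<b. (\<Sum>k<M. u k * g j i k) = 0)}"
proof -
  let ?Z = "{j. j < n \<and> (\<forall>i<b. (\<Sum>k<M. u k * g j i k) = 0)}"
  have "{j. j < n \<and> (\<exists>i<b. encode M b n g u i j \<noteq> 0)} = {..<n} - ?Z"
    by (auto simp: encode_def)
  moreover have "card ({..<n} - ?Z) = n - card ?Z" by (subst card_Diff_subset) auto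
  ultimately show ?thesis by (simp add: array_weight_def)
qed

lemma card_bij_betw_filter:
  assumes "bij_betw f A B"
  shows "card {a \<in> A. P (f a)} = card {b \<in> B. P b}"
proof -
  have "{b \<in> B. P b} = f ` {a \<in> A. P (f a)}" using assms by (auto simp: bij_betw_def)
  moreover have "inj_on f {a \<in> A. P (f a)}"
    using assms by (auto simp: bij_betw_def inj_on_def)
  ultimately show ?thesis by (simp add: card_image)
qed

locale full_rank_array_code = full_rank_family \<D> \<A> b m
  for \<D> \<A> :: "(nat \<Rightarrow> nat \<Rightarrow> 'a::{finite,field}) set" and b m :: nat +
  fixes n :: nat and Dj :: "nat \<Rightarrow> nat \<Rightarrow> nat \<Rightarrow> 'a" and g :: "nat \<Rightarrow> nat \<Rightarrow> nat \<Rightarrow> 'a"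
  assumes bij: "bij_betw Dj {..<n} \<D>"
    and basis: "\<And>j. j < n \<Longrightarrow> is_basis b (VD b (Dj j)) (g j)"
begin

lemma Dj_mem: "j < n \<Longrightarrow> Dj j \<in> \<D>"
  using bij_betw_apply[OF bij] by simp

lemma n_eq: "n = card \<D>"
  using bij_betw_same_card[OF bij] by simp

lemma n_pos: "0 < n"
  using D_fin D_sub by (auto simp: n_eq card_gt_0_iff mat_subspace_def)

lemma g_mem: "j < n \<Longrightarrow> i < b \<Longrightarrow> g j i \<in> VD b (Dj j)"
  using basis by (simp add: is_basis_def)

text \<open>Along the enumeration \<open>Dj\<close>, the vanishing columns become a fibre of
  \<open>D \<mapsto> D y\<close>, with \<open>y\<close> the tail of \<open>u\<close>.\<close>

lemma weight_encode:
  "array_weight b n (encode (b + m) b n g u) =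
    n - card {D \<in> \<D>. mulv m D (\<lambda>l. u (b + l)) = (\<lambda>i. if i < b then - u i else 0)}"
proof -
  let ?P = "\<lambda>D. mulv m D (\<lambda>l. u (b + l)) = (\<lambda>i. if i < b then - u i else 0)"
  have "(\<forall>i<b. (\<Sum>k<b + m. u k * g j i k) = 0) \<longleftrightarrow> ?P (Dj j)" if "j < n" for j
    using column_eq_0_iff[of "Dj j" b m "g j" u] Dj_mem[OF that] D_mats basis[OF that] by blast
  then have "{j. j < n \<and> (\<forall>i<b. (\<Sum>k<b + m. u k * g j i k) = 0)} = {j \<in> {..<n}. ?P (Dj j)}"
    by blast
  then show ?thesis
    using card_bij_betw_filter[OF bij, of ?P] by (simp add: array_weight_encode)
qed

text \<open>When the tail is 0, every \<open>D y\<close> is 0 while the head of \<open>u\<close> is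
  not, so no column vanishes.\<close>

lemma weight_encode_low:
  assumes u: "u \<in> fvec (b + m)" "u \<noteq> 0" and low: "\<And>l. l < m \<Longrightarrow> u (b + l) = 0"
  shows "array_weight b n (encode (b + m) b n g u) = n"
proof -
  have "\<exists>i<b. u i \<noteq> 0"
  proof (rule ccontr)
    assume *: "\<not> (\<exists>i<b. u i \<noteq> 0)"
    have "u k = 0" for k
    proof (cases "k < b")
      case True
      then show ?thesis using * by blast
    next
      case False
      then have k: "k = b + (k - b)" by simp
      show ?thesis
      proof (cases "k < b + m")
        case True
        then show ?thesis using low[of "k - b"] False by simp
      next
        case False
        then show ?thesis using u by (simp add: fvec_def)
      qed
    qed
    then show False using u by (auto simp: fun_eq_iff)
  qed
  then obtain i where i: "i < b" "u i \<noteq> 0" by blast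
  have "mulv m D (\<lambda>l. u (b + l)) \<noteq> (\<lambda>i. if i < b then - u i else 0)" for D
  proof
    assume "mulv m D (\<lambda>l. u (b + l)) = (\<lambda>i. if i < b then - u i else 0)"
    from fun_cong[OF this, of i] show False using i low by (simp add: mulv_def)
  qed
  then show ?thesis by (simp add: weight_encode)
qed

text \<open>For a nonzero tail, exactly \<open>z\<close> matrices lie in the fibre of vanishing
  columns.\<close>

lemma weight_encode_high:
  assumes "l < m" "u (b + l) \<noteq> 0" and card: "card \<D> = card (UNIV :: 'a set) ^ b * z"
  shows "array_weight b n (encode (b + m) b n g u) = n - z"
proof -
  have "(\<lambda>i. if i < b then - u i else 0) \<in> fvec b" by (simp add: fvec_def)
  from card_mulv_fibre[of l "\<lambda>l. u (b + l)", OF assms(1,2) this] card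
  show ?thesis by (simp add: weight_encode)
qed

section \<open>Dimension and minimum distance\<close>

context
  fixes z :: nat
  assumes m_pos: "0 < m" and card_D: "card \<D> = card (UNIV :: 'a set) ^ b * z"
    and z_less: "z < card \<D>"
begin

lemma weight_encode_cases:
  assumes "u \<in> fvec (b + m)" "u \<noteq> 0"
  shows "array_weight b n (encode (b + m) b n g u) \<in> {n - z, n}"
  using weight_encode_low[OF assms] weight_encode_high[OF _ _ card_D, of _ u] by blast

text \<open>Both possible weights of a nonzero message, \<open>n - z\<close> and \<open>n\<close>,
  are positive.\<close>

lemma encode_eq_0_imp:
  assumes u: "u \<in> fvec (b + m)" and 0: "encode (b + m) b n g u = 0"
  shows "u = 0"
proof (rule ccontr)
  assume "u \<noteq> 0"
  then have "array_weight b n (encode (b + m) b n g u) \<noteq> 0"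
    using weight_encode_cases[OF u] n_pos z_less by (auto simp: n_eq)
  then show False by (simp add: 0 array_weight_def)
qed

lemma card_array_code: "card (array_code (b + m) b n g) = card (UNIV :: 'a set) ^ (b + m)"
proof -
  have "inj_on (encode (b + m) b n g) (fvec (b + m))"
  proof (rule inj_onI)
    fix u w assume uw: "u \<in> fvec (b + m)" "w \<in> fvec (b + m)"
      "encode (b + m) b n g u = encode (b + m) b n g w"
    have "u - w \<in> fvec (b + m)" using uw(1,2) by (simp add: fvec_def)
    moreover have "encode (b + m) b n g (u - w) = 0" using uw(3) by (simp add: encode_diff)
    ultimately have "u - w = 0" by (rule encode_eq_0_imp)
    then show "u = w" by simp
  qed
  then show ?thesis by (simp add: array_code_def card_image card_fvec)
qed

lemma min_distance_array_code: "min_distance b n (array_code (b + m) b n g) = n - z"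
proof -
  let ?W = "{array_weight b n A | A. A \<in> array_code (b + m) b n g \<and> A \<noteq> 0}"
  have W: "w \<in> {n - z, n}" if w: "w \<in> ?W" for w
  proof -
    obtain u where u: "u \<in> fvec (b + m)" "encode (b + m) b n g u \<noteq> 0"
      "w = array_weight b n (encode (b + m) b n g u)"
      using w by (auto simp: array_code_def)
    have "encode (b + m) b n g 0 = 0" by (simp add: encode_def fun_eq_iff)
    then have "u \<noteq> 0" using u(2) by metis
    then show ?thesis using weight_encode_cases[OF u(1)] u(3) by simp
  qed
  have "finite ?W" using W by (intro finite_subset[of ?W "{n - z, n}"]) auto
  moreover have "n - z \<in> ?W"
  proof -
    \<comment> \<open>Position \<open>b\<close> is the first of the tail, so this message attains
      the smaller weight; \<open>0 < m\<close> keeps it within the length.\<close>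
    let ?u = "\<lambda>k. if k = b then 1 else (0 :: 'a)"
    have u: "?u \<in> fvec (b + m)" using m_pos by (auto simp: fvec_def)
    have "?u \<noteq> 0" by (auto simp: fun_eq_iff)
    then have "encode (b + m) b n g ?u \<noteq> 0" using encode_eq_0_imp[OF u] by blast
    moreover have "array_weight b n (encode (b + m) b n g ?u) = n - z"
      by (rule weight_encode_high[OF m_pos _ card_D]) simp
    ultimately show ?thesis using u by (force simp: array_code_def)
  qed
  moreover have "n - z \<le> w" if "w \<in> ?W" for w using W[OF that] by auto
  ultimately show ?thesis unfolding min_distance_def by (intro Min_eqI) auto
qed

end

section \<open>Columns sharing a symbol\<close>

lemma card_other_columns_containing:
  assumes ji: "j < n" "i < b" and card: "card \<D> = card (UNIV :: 'a set) ^ m * s"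
  shows "card {k. k < n \<and> k \<noteq> j \<and> g j i \<in> VD b (Dj k)} = s - 1"
proof -
  let ?K = "{k \<in> {..<n}. g j i \<in> VD b (Dj k)}"
  have "card (UNIV :: 'a set) ^ m * card {E \<in> \<D>. g j i \<in> VD b E} = card \<D>"
    using card_VD_containing[OF Dj_mem[OF ji(1)] g_mem[OF ji] is_basis_nonzero[OF basis ji(2)]] ji
    by simp
  then have "card {E \<in> \<D>. g j i \<in> VD b E} = s" using card by simp
  then have "card ?K = s"
    using card_bij_betw_filter[OF bij, of "\<lambda>E. g j i \<in> VD b E"] by simp
  moreover have "{k. k < n \<and> k \<noteq> j \<and> g j i \<in> VD b (Dj k)} = ?K - {j}" by auto
  \<comment> \<open>Column \<open>j\<close> contains its own symbol, which accounts for the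
    \<open>- 1\<close>.\<close>
  moreover have "j \<in> ?K" using ji g_mem by simp
  ultimately show ?thesis by simp
qed

lemma node_locality_VD:
  assumes "0 < b"
  shows "2 \<le> node_locality n (\<lambda>j. VD b (Dj j))"
proof (rule node_locality_ge_2[OF n_pos])
  show "\<not> VD b (Dj j) \<subseteq> {0}" if "j < n" for j
    using g_mem[OF that assms] is_basis_nonzero[OF basis[OF that] assms] by blast
  show "j = k" if "j < n" "k < n" "VD b (Dj j) \<subseteq> VD b (Dj k)" for j k
  proof -
    have "Dj j = Dj k"
      using VD_subset_imp_eq[of "Dj j" b m "Dj k"] that Dj_mem D_mats by blast
    then show ?thesis using bij that by (simp add: bij_betw_def inj_on_def)
  qed
qed

text \<open>Each symbol lies in \<open>s - 1\<close> other columns: \<open>2 \<le> s\<close>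
  provides one of them, giving locality 1, and their number is the availability.\<close>

lemma symbol_locality_availability_VD:
  assumes b: "0 < b" and s: "2 \<le> s" and card: "card \<D> = card (UNIV :: 'a set) ^ m * s"
  shows "symbol_locality b n (\<lambda>j. VD b (Dj j)) g = 1"
    and "symbol_availability b n (\<lambda>j. VD b (Dj j)) g = enat (s - 1)"
proof -
  have nz: "g j i \<noteq> 0" if "j < n" "i < b" for i j
    using is_basis_nonzero[OF basis] that by blast
  show loc: "symbol_locality b n (\<lambda>j. VD b (Dj j)) g = 1"
  proof (rule symbol_locality_eq_1[OF n_pos b nz])
    fix i j assume "j < n" "i < b"
    then have "card {k. k < n \<and> k \<noteq> j \<and> g j i \<in> VD b (Dj k)} \<noteq> 0"
      using card_other_columns_containing[OF _ _ card] s by simp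
    then have "{k. k < n \<and> k \<noteq> j \<and> g j i \<in> VD b (Dj k)} \<noteq> {}" by (metis card.empty)
    then show "\<exists>k<n. k \<noteq> j \<and> g j i \<in> VD b (Dj k)" by blast
  qed
  show "symbol_availability b n (\<lambda>j. VD b (Dj j)) g = enat (s - 1)"
    using card_other_columns_containing[OF _ _ card]
    by (intro symbol_availability_of_locality_1[OF n_pos b nz loc])
qed

end

section \<open>The parameters of the code\<close>

theorem mainTheorem14:
  fixes \<D> \<A> :: "(nat \<Rightarrow> nat \<Rightarrow> 'a::{finite,field}) set"
    and q M b t n :: nat
    and Dj :: "nat \<Rightarrow> (nat \<Rightarrow> nat \<Rightarrow> 'a)"
    and g :: "nat \<Rightarrow> nat \<Rightarrow> nat \<Rightarrow> 'a"
  assumes q_def: "q = card (UNIV :: 'a set)"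
    and t_ge: "2 \<le> t" and t_le: "t \<le> b" and b_le: "b \<le> M - b"
    and D_mats: "\<D> \<subseteq> fmat b (M - b)" and D_sub: "mat_subspace \<D>"
    and D_card: "card \<D> = q ^ ((M - b) * t)"
    and A_in: "\<A> \<subseteq> \<D>" and A_sub: "mat_subspace \<A>"
    and A_card: "card \<A> = q ^ (M - b)"
    and A_rank: "\<forall>A\<in>\<A>. A \<noteq> 0 \<longrightarrow> mat_rank b A = b"
    and n_def: "n = card \<D>"
    and Dj_bij: "bij_betw Dj {..<n} \<D>"
    and g_basis: "\<forall>j<n. is_basis b (VD b (Dj j)) (g j)"
  shows "n = q ^ ((M - b) * t)
    \<and> card (array_code M b n g) = q ^ M
    \<and> min_distance b n (array_code M b n g)
        = q ^ ((M - b) * (t - 1)) * (q ^ (M - b) - q ^ (M - 2 * b))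
    \<and> symbol_locality b n (\<lambda>j. VD b (Dj j)) g = 1
    \<and> node_locality n (\<lambda>j. VD b (Dj j)) \<ge> 2
    \<and> symbol_availability b n (\<lambda>j. VD b (Dj j)) g = enat (q ^ ((M - b) * (t - 1)) - 1)"
proof -
  define m where "m = M - b"
  have b: "2 \<le> b" and bm: "b \<le> m" and M: "M = b + m" using t_ge t_le b_le by (auto simp: m_def)
  have "card {0, 1 :: 'a} \<le> q" unfolding q_def by (rule card_mono) auto
  then have q2: "2 \<le> q" by simp
  \<comment> \<open>\<open>z\<close> is the fibre size of \<open>D \<mapsto> D y\<close> for nonzero
    \<open>y\<close>, and \<open>s\<close> that of \<open>D \<mapsto> x D\<close> for nonzero
    \<open>x\<close>.\<close>
  define z where "z = q ^ (m * t - b)"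
  define s where "s = q ^ (m * (t - 1))"
  have mt: "m * t = m + m * (t - 1)" using t_ge by (cases t) auto
  have z: "card \<D> = q ^ b * z"
    using bm mt by (simp add: D_card z_def m_def[symmetric] power_add[symmetric])
  have s: "card \<D> = q ^ m * s"
    by (simp add: D_card s_def m_def[symmetric] mt power_add)
  \<comment> \<open>A positive \<open>card\<close> rules out the default value 0 of infinite
    sets.\<close>
  have "0 < card \<D>" using D_card q2 by simp
  then have D_fin: "finite \<D>" by (rule card_ge_0_finite)
  have "1 < q ^ b" using q2 b by (intro one_less_power) auto
  moreover have "0 < z" using q2 by (simp add: z_def)
  ultimately have z_less: "z < card \<D>" by (simp add: z)
  have "q ^ 1 \<le> s" unfolding s_def using q2 b bm t_ge by (intro power_increasing) auto
  then have s2: "2 \<le> s" using q2 by simp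
  \<comment> \<open>Splitting the exponent lets \<open>s\<close> be factored out of
    \<open>n - z\<close>; \<open>b \<le> m\<close> keeps the subtraction exact.\<close>
  have "m * t - b = m * (t - 1) + (m - b)" using bm mt by simp
  then have "z = s * q ^ (m - b)" by (simp add: z_def s_def power_add)
  moreover have "M - 2 * b = m - b" by (simp add: M)
  ultimately have d: "n - z = s * (q ^ m - q ^ (M - 2 * b))"
    by (simp add: n_def s diff_mult_distrib2 mult.commute)
  interpret full_rank_array_code \<D> \<A> b m n Dj g
    using D_mats D_sub D_fin A_in A_sub A_card A_rank Dj_bij g_basis
    by unfold_locales (auto simp: m_def q_def)
  have "n = q ^ (m * t)" using n_def D_card by (simp add: m_def)
  moreover have "card (array_code M b n g) = q ^ M"
    using card_array_code[of z] b bm z z_less by (simp add: M q_def)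
  moreover have "min_distance b n (array_code M b n g) = s * (q ^ m - q ^ (M - 2 * b))"
    using min_distance_array_code[of z] b bm z z_less d by (simp add: M q_def)
  moreover have "symbol_locality b n (\<lambda>j. VD b (Dj j)) g = 1"
    and "symbol_availability b n (\<lambda>j. VD b (Dj j)) g = enat (s - 1)"
    using symbol_locality_availability_VD[of s] b s s2 by (simp_all add: q_def)
  moreover have "node_locality n (\<lambda>j. VD b (Dj j)) \<ge> 2" using node_locality_VD b by simp
  ultimately show ?thesis unfolding s_def m_def by blast
qed

end
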